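(* Let $(x_n)$ and $(y_n)$ be two fast convergent sequences. If $E(x_n)=E(y_n)$, then $x_n=y_n$ for all $n\in\mathbb{N}$.
   Context: All sequences $(x_n)_{n\in\mathbb{N}}$ considered are infinite, non-increasing, summable sequences of positive real numbers. The achievement set (set of subsums) of $(x_n)$ is $E(x_n)=\{\sum_{n\in A}x_n : A\subset\mathbb{N}\}$. The sequence $(x_n)$ is fast convergent if $x_n>\sum_{i>n}x_i$ for every $n\in\mathbb{N}$. *)

theory Defs
  imports "HOL-Analysis.Analysis"
begin

definition seq_admissible :: "(nat \<Rightarrow> real) \<Rightarrow> bool" where
  "seq_admissible x \<longleftrightarrow> (\<forall>n. x n > 0) \<and> decseq x \<and> summable x"

text \<open>
  Unordered sums (\<^const>\<open>infsum\<close>) are used since the index set \<open>A\<close> may be finite or infinite.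
  For an admissible \<open>x\<close> every subfamily is summable, so no term below takes the default value 0
  of a divergent sum. Sequences are indexed from 0.
\<close>

definition achievement_set :: "(nat \<Rightarrow> real) \<Rightarrow> real set" where
  "achievement_set x = {\<Sum>\<^sub>\<infinity>n\<in>A. x n | A. A \<subseteq> (UNIV :: nat set)}"

definition fast_convergent :: "(nat \<Rightarrow> real) \<Rightarrow> bool" where
  "fast_convergent x \<longleftrightarrow> (\<forall>n. x n > (\<Sum>\<^sub>\<infinity>i\<in>{n<..}. x i))"

end

theory Submission
  imports Defs
begin

text \<open>
  Induct on \<open>n\<close>, with \<open>x\<close> and \<open>y\<close> agreeing below \<open>n\<close>. Since \<open>max E(x) = max E(y)\<close> is
  the total sum, the tails from \<open>n\<close> on have the same sum. If \<open>x n < y n\<close>, then \<open>x n\<close> is a subsum of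
  \<open>y\<close> that uses only indices \<open>> n\<close>, so \<open>x n \<le> (\<Sum>i>n. y i) = x n - y n + (\<Sum>i>n. x i)\<close>, which
  is less than \<open>x n\<close> because \<open>(\<Sum>i>n. x i) < x n < y n\<close>.
\<close>

lemma seq_admissible_summable_on:
  assumes "seq_admissible x"
  shows "x summable_on A"
proof -
  have "x summable_on UNIV"
    using assms unfolding seq_admissible_def
    by (subst summable_on_UNIV_nonneg_real_iff) (auto intro: less_imp_le)
  then show ?thesis
    by (rule summable_on_subset_banach) simp
qed

lemma seq_admissible_infsum_mono:
  assumes "seq_admissible x" and "A \<subseteq> B"
  shows "infsum x A \<le> infsum x B"
  using assms
  by (intro infsum_mono2) (auto simp: seq_admissible_summable_on seq_admissible_def less_imp_le)

text \<open>The full index set gives a subsum of \<open>x\<close>, hence one of \<open>y\<close>,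
  and positivity bounds that by the total of \<open>y\<close>.\<close>

lemma infsum_UNIV_le_of_achievement_set_subset:
  assumes "seq_admissible y" and "achievement_set x \<subseteq> achievement_set y"
  shows "infsum x UNIV \<le> infsum y UNIV"
proof -
  have "infsum x UNIV \<in> achievement_set y"
    using assms(2) unfolding achievement_set_def by auto
  then obtain A where "infsum x UNIV = infsum y A"
    unfolding achievement_set_def by auto
  then show ?thesis
    using seq_admissible_infsum_mono[OF assms(1), of A UNIV] by simp
qed

lemma infsum_UNIV_split_at:
  assumes "seq_admissible x"
  shows "infsum x UNIV = (\<Sum>i<n. x i) + x n + infsum x {n<..}"
proof -
  have "infsum x ({..n} \<union> {n<..}) = infsum x {..n} + infsum x {n<..}"
    by (intro infsum_Un_disjoint seq_admissible_summable_on assms) auto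
  moreover have "{..n} \<union> {n<..} = UNIV"
    by auto
  moreover have "infsum x {..n} = (\<Sum>i<n. x i) + x n"
    by (simp flip: lessThan_Suc_atMost)
  ultimately show ?thesis
    by simp
qed

text \<open>One-sided, so that exchanging \<open>x\<close> and \<open>y\<close> yields the reverse
  inequality in the induction.\<close>

lemma fast_convergent_first_difference_ge:
  assumes x: "seq_admissible x" and y: "seq_admissible y"
    and fast: "fast_convergent x"
    and E: "achievement_set x = achievement_set y"
    and agree: "\<And>i. i < n \<Longrightarrow> x i = y i"
  shows "y n \<le> x n"
proof (rule ccontr)
  assume "\<not> y n \<le> x n"
  then have less: "x n < y n" by simp
  have "infsum x {n} \<in> achievement_set x"
    unfolding achievement_set_def by blast
  then obtain A where A: "x n = infsum y A"
    unfolding E by (auto simp: achievement_set_def)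
  \<comment> \<open>An index \<open>i \<le> n\<close> in \<open>A\<close> would contribute
    \<open>y i \<ge> y n > x n\<close>, already more than the whole subsum.\<close>
  have "A \<subseteq> {n<..}"
  proof
    fix i assume "i \<in> A"
    then have "y i \<le> x n"
      using seq_admissible_infsum_mono[OF y, of "{i}" A] A by simp
    with less have "y i < y n" by simp
    moreover have "decseq y"
      using y by (simp add: seq_admissible_def)
    ultimately show "i \<in> {n<..}"
      by (metis decseqD greaterThan_iff not_le)
  qed
  then have "x n \<le> infsum y {n<..}"
    unfolding A by (rule seq_admissible_infsum_mono[OF y])
  moreover have "infsum x UNIV = infsum y UNIV"
    using infsum_UNIV_le_of_achievement_set_subset x y E by (metis order.eq_iff)
  moreover have "(\<Sum>i<n. x i) = (\<Sum>i<n. y i)"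
    using agree by simp
  moreover have "infsum x {n<..} < x n"
    using fast by (simp add: fast_convergent_def)
  \<comment> \<open>Cancelling the common initial sums leaves
    \<open>x n + infsum x {n<..} = y n + infsum y {n<..}\<close>. The last tail is at least
    \<open>x n\<close>, so \<open>y n \<le> infsum x {n<..} < x n\<close>.\<close>
  ultimately show False
    using less infsum_UNIV_split_at[OF x, of n] infsum_UNIV_split_at[OF y, of n] by linarith
qed

theorem theorem1p14:
  fixes x y :: "nat \<Rightarrow> real"
  assumes "seq_admissible x" and "seq_admissible y"
    and "fast_convergent x" and "fast_convergent y"
    and "achievement_set x = achievement_set y"
  shows "\<forall>n. x n = y n"
proof
  fix n
  show "x n = y n"
  proof (induction n rule: less_induct)
    case (less n)
    then show ?case
      using assms fast_convergent_first_difference_ge[of x y n]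
        fast_convergent_first_difference_ge[of y x n]
      by (metis order.antisym)
  qed
qed

end
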